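(* Let $V$ be a finite dimensional hypervector space over a hyperfield $F$. Then every linearly independent set of vectors in $V$ is either a basis of $V$ or can be extended to a basis of $V$.
   Context: A hyperoperation on a non-empty set $X$ is a map $X\times X\to P^*(X)$, where $P^*(X)$ is the set of non-empty subsets of $X$. All operations are extended to subsets by unions, e.g. $A\# B=\bigcup_{a\in A,b\in B}a\# b$, $a\ast A=\bigcup_{\alpha\in A}a\ast\alpha$, $B\ast\alpha=\bigcup_{b\in B}b\ast\alpha$; singletons are identified with their elements. A commutative hypergroup $(X,\#)$ is a non-empty set with a commutative hyperoperation such that (1) $x\#(y\# z)=(x\# y)\# z$; (2) there is $0\in X$ such that for every $a\in X$ there is a unique $b\in X$ with $0\in a\# b$ and $0\in b\# a$, and this $b$ is denoted $-a$; (3) $a\in b\# c$ implies $b\in a\#(-c)$. (The zero element is then unique.) A hyperfield $(F,\oplus,\cdot)$ is a commutative hypergroup $(F,\oplus)$ with zero element $0$ together with a single-valued, associative, commutative multiplication $\cdot$ that distributes over $\oplus$ (equality of sets, both sides), with $a\cdot 0=0\cdot a=0$ for all $a$, with an identity $1_F$, and such that each $a\ne0$ has $a^{-1}$ with $a\cdot a^{-1}=1_F$. A hypervector space $V$ over $F$ is a commutative hypergroup $(V,\#)$ with zero vector $\theta$, together with a map $\ast:F\times V\to P^*(V)$ such that for all $a,b\in F$, $\alpha,\beta\in V$: (i) $a\ast(\alpha\#\beta)\subseteq a\ast\alpha\# a\ast\beta$; (ii) $(a\oplus b)\ast\alpha\subseteq a\ast\alpha\# b\ast\alpha$; (iii)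 $(a\cdot b)\ast\alpha=a\ast(b\ast\alpha)$; (iv) $1_F\ast\alpha=\{\alpha\}$ and $0\ast\alpha=\{\theta\}$. A finite subset $\{\alpha_1,\dots,\alpha_n\}$ of $V$ is linearly dependent if there are $a_1,\dots,a_n\in F$, not all zero, with $\theta\in a_1\ast\alpha_1\#\cdots\# a_n\ast\alpha_n$. An arbitrary subset is linearly dependent if it contains a finite linearly dependent subset; otherwise it is linearly independent. A vector $\alpha$ is a linear combination of $\alpha_1,\dots,\alpha_n$ if $\alpha\in a_1\ast\alpha_1\#\cdots\# a_n\ast\alpha_n$ for some $a_i\in F$; by convention the only linear combination of the empty family is $\theta$. A subset $S\subseteq V$ is a basis (Hamel basis) of $V$ if $S$ is linearly independent and every element of $V$ is a linear combination of finitely many elements of $S$. $V$ is finite dimensional if it has a finite basis. *)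

theory Defs
  imports Main
begin

record 'a hypergroup =
  carrier :: "'a set"
  hadd :: "'a \<Rightarrow> 'a \<Rightarrow> 'a set"  (infixl "\<oplus>\<index>" 65)
  hzero :: 'a  ("\<zero>\<index>")

definition set_hadd :: "('a, 'm) hypergroup_scheme \<Rightarrow> 'a set \<Rightarrow> 'a set \<Rightarrow> 'a set"
    (infixl "\<boxplus>\<index>" 65) where
  "A \<boxplus>\<^bsub>X\<^esub> B = (\<Union>a\<in>A. \<Union>b\<in>B. a \<oplus>\<^bsub>X\<^esub> b)"

definition hneg :: "('a, 'm) hypergroup_scheme \<Rightarrow> 'a \<Rightarrow> 'a"  ("\<ominus>\<index> _" [81] 80) where
  "\<ominus>\<^bsub>X\<^esub> a =
     (THE b. b \<in> carrier X \<and> \<zero>\<^bsub>X\<^esub> \<in> a \<oplus>\<^bsub>X\<^esub> b \<and> \<zero>\<^bsub>X\<^esub> \<in> b \<oplus>\<^bsub>X\<^esub> a)"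

text \<open>The zero element is part of the structure; the axioms determine it uniquely.\<close>

locale comm_hypergroup =
  fixes X :: "('a, 'm) hypergroup_scheme" (structure)
  assumes hadd_subset: "\<lbrakk>a \<in> carrier X; b \<in> carrier X\<rbrakk> \<Longrightarrow> a \<oplus> b \<subseteq> carrier X"
    and hadd_nonempty: "\<lbrakk>a \<in> carrier X; b \<in> carrier X\<rbrakk> \<Longrightarrow> a \<oplus> b \<noteq> {}"
    and hadd_comm: "\<lbrakk>a \<in> carrier X; b \<in> carrier X\<rbrakk> \<Longrightarrow> a \<oplus> b = b \<oplus> a"
    and hadd_assoc: "\<lbrakk>x \<in> carrier X; y \<in> carrier X; z \<in> carrier X\<rbrakk>
          \<Longrightarrow> {x} \<boxplus> (y \<oplus> z) = (x \<oplus> y) \<boxplus> {z}"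
    and hzero_closed: "\<zero> \<in> carrier X"
    and hneg_unique: "a \<in> carrier X \<Longrightarrow> \<exists>!b. b \<in> carrier X \<and> \<zero> \<in> a \<oplus> b \<and> \<zero> \<in> b \<oplus> a"
    and hadd_reversible: "\<lbrakk>a \<in> carrier X; b \<in> carrier X; c \<in> carrier X; a \<in> b \<oplus> c\<rbrakk>
          \<Longrightarrow> b \<in> a \<oplus> (\<ominus> c)"

record 'a hyperfield = "'a hypergroup" +
  hmult :: "'a \<Rightarrow> 'a \<Rightarrow> 'a"  (infixl "\<otimes>\<index>" 70)
  hone :: 'a  ("\<one>\<index>")

text \<open>As in the source, \<open>\<one> \<noteq> \<zero>\<close> is not required.\<close>

locale hyperfield = comm_hypergroup F for F :: "('a, 'm) hyperfield_scheme" (structure) +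
  assumes hmult_closed: "\<lbrakk>a \<in> carrier F; b \<in> carrier F\<rbrakk> \<Longrightarrow> a \<otimes> b \<in> carrier F"
    and hmult_assoc: "\<lbrakk>a \<in> carrier F; b \<in> carrier F; c \<in> carrier F\<rbrakk>
          \<Longrightarrow> (a \<otimes> b) \<otimes> c = a \<otimes> (b \<otimes> c)"
    and hmult_comm: "\<lbrakk>a \<in> carrier F; b \<in> carrier F\<rbrakk> \<Longrightarrow> a \<otimes> b = b \<otimes> a"
    and distrib_left: "\<lbrakk>a \<in> carrier F; b \<in> carrier F; c \<in> carrier F\<rbrakk>
          \<Longrightarrow> (\<lambda>x. a \<otimes> x) ` (b \<oplus> c) = (a \<otimes> b) \<oplus> (a \<otimes> c)"
    and distrib_right: "\<lbrakk>a \<in> carrier F; b \<in> carrier F; c \<in> carrier F\<rbrakk>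
          \<Longrightarrow> (\<lambda>x. x \<otimes> a) ` (b \<oplus> c) = (b \<otimes> a) \<oplus> (c \<otimes> a)"
    and hmult_zero_right: "a \<in> carrier F \<Longrightarrow> a \<otimes> \<zero> = \<zero>"
    and hmult_zero_left: "a \<in> carrier F \<Longrightarrow> \<zero> \<otimes> a = \<zero>"
    and hone_closed: "\<one> \<in> carrier F"
    and hmult_one_right: "a \<in> carrier F \<Longrightarrow> a \<otimes> \<one> = a"
    and hmult_one_left: "a \<in> carrier F \<Longrightarrow> \<one> \<otimes> a = a"
    and hmult_inverse: "\<lbrakk>a \<in> carrier F; a \<noteq> \<zero>\<rbrakk> \<Longrightarrow> \<exists>b\<in>carrier F. a \<otimes> b = \<one>"

record ('v, 'f) hypervector = "'v hypergroup" +
  smult :: "'f \<Rightarrow> 'v \<Rightarrow> 'v set"  (infixr "\<odot>\<index>" 75)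

locale hypervector_space =
  hyperfield F + comm_hypergroup V
  for F :: "('f, 'm) hyperfield_scheme" and V :: "('v, 'f, 'n) hypervector_scheme" +
  assumes smult_subset: "\<lbrakk>a \<in> carrier F; \<alpha> \<in> carrier V\<rbrakk> \<Longrightarrow> a \<odot>\<^bsub>V\<^esub> \<alpha> \<subseteq> carrier V"
    and smult_nonempty: "\<lbrakk>a \<in> carrier F; \<alpha> \<in> carrier V\<rbrakk> \<Longrightarrow> a \<odot>\<^bsub>V\<^esub> \<alpha> \<noteq> {}"
    and smult_hadd_right: "\<lbrakk>a \<in> carrier F; \<alpha> \<in> carrier V; \<beta> \<in> carrier V\<rbrakk>
          \<Longrightarrow> (\<Union>\<gamma>\<in>\<alpha> \<oplus>\<^bsub>V\<^esub> \<beta>. a \<odot>\<^bsub>V\<^esub> \<gamma>) \<subseteq> (a \<odot>\<^bsub>V\<^esub> \<alpha>) \<boxplus>\<^bsub>V\<^esub> (a \<odot>\<^bsub>V\<^esub> \<beta>)"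
    and smult_hadd_left: "\<lbrakk>a \<in> carrier F; b \<in> carrier F; \<alpha> \<in> carrier V\<rbrakk>
          \<Longrightarrow> (\<Union>c\<in>a \<oplus>\<^bsub>F\<^esub> b. c \<odot>\<^bsub>V\<^esub> \<alpha>) \<subseteq> (a \<odot>\<^bsub>V\<^esub> \<alpha>) \<boxplus>\<^bsub>V\<^esub> (b \<odot>\<^bsub>V\<^esub> \<alpha>)"
    and smult_assoc: "\<lbrakk>a \<in> carrier F; b \<in> carrier F; \<alpha> \<in> carrier V\<rbrakk>
          \<Longrightarrow> (a \<otimes>\<^bsub>F\<^esub> b) \<odot>\<^bsub>V\<^esub> \<alpha> = (\<Union>\<beta>\<in>b \<odot>\<^bsub>V\<^esub> \<alpha>. a \<odot>\<^bsub>V\<^esub> \<beta>)"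
    and smult_one: "\<alpha> \<in> carrier V \<Longrightarrow> \<one>\<^bsub>F\<^esub> \<odot>\<^bsub>V\<^esub> \<alpha> = {\<alpha>}"
    and smult_zero: "\<alpha> \<in> carrier V \<Longrightarrow> \<zero>\<^bsub>F\<^esub> \<odot>\<^bsub>V\<^esub> \<alpha> = {\<zero>\<^bsub>V\<^esub>}"

text \<open>The sum of no sets is the singleton of the zero vector, so that the only linear
  combination of the empty family is the zero vector.\<close>

fun hsum :: "('a, 'm) hypergroup_scheme \<Rightarrow> 'a set list \<Rightarrow> 'a set" where
  "hsum X [] = {\<zero>\<^bsub>X\<^esub>}"
| "hsum X [A] = A"
| "hsum X (A # B # As) = A \<boxplus>\<^bsub>X\<^esub> hsum X (B # As)"

definition comb :: "('v, 'f, 'n) hypervector_scheme \<Rightarrow> 'f list \<Rightarrow> 'v list \<Rightarrow> 'v set" where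
  "comb V as \<alpha>s = hsum V (map2 (\<lambda>a \<alpha>. a \<odot>\<^bsub>V\<^esub> \<alpha>) as \<alpha>s)"

definition linear_combination ::
    "('f, 'm) hyperfield_scheme \<Rightarrow> ('v, 'f, 'n) hypervector_scheme \<Rightarrow> 'v \<Rightarrow> 'v list \<Rightarrow> bool" where
  "linear_combination F V \<alpha> \<alpha>s \<longleftrightarrow>
     (\<exists>as. length as = length \<alpha>s \<and> set as \<subseteq> carrier F \<and> \<alpha> \<in> comb V as \<alpha>s)"

text \<open>A finite set of vectors is enumerated without repetition; the choice of the enumeration
  is immaterial because hyperaddition is associative and commutative.\<close>

definition fin_linearly_dependent ::
    "('f, 'm) hyperfield_scheme \<Rightarrow> ('v, 'f, 'n) hypervector_scheme \<Rightarrow> 'v set \<Rightarrow> bool" where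
  "fin_linearly_dependent F V A \<longleftrightarrow>
     (\<exists>\<alpha>s as. distinct \<alpha>s \<and> set \<alpha>s = A \<and> length as = length \<alpha>s \<and> set as \<subseteq> carrier F \<and>
        (\<exists>a\<in>set as. a \<noteq> \<zero>\<^bsub>F\<^esub>) \<and> \<zero>\<^bsub>V\<^esub> \<in> comb V as \<alpha>s)"

definition linearly_dependent ::
    "('f, 'm) hyperfield_scheme \<Rightarrow> ('v, 'f, 'n) hypervector_scheme \<Rightarrow> 'v set \<Rightarrow> bool" where
  "linearly_dependent F V S \<longleftrightarrow>
     S \<subseteq> carrier V \<and> (\<exists>A. A \<subseteq> S \<and> finite A \<and> fin_linearly_dependent F V A)"

definition linearly_independent ::
    "('f, 'm) hyperfield_scheme \<Rightarrow> ('v, 'f, 'n) hypervector_scheme \<Rightarrow> 'v set \<Rightarrow> bool" where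
  "linearly_independent F V S \<longleftrightarrow> S \<subseteq> carrier V \<and> \<not> linearly_dependent F V S"

text \<open>``Finitely many elements of \<open>S\<close>'' are distinct. This matters: \<open>a \<odot> \<alpha> \<boxplus> b \<odot> \<alpha>\<close> can be
  strictly larger than the set of all vectors in some \<open>c \<odot> \<alpha>\<close>.\<close>

definition is_basis ::
    "('f, 'm) hyperfield_scheme \<Rightarrow> ('v, 'f, 'n) hypervector_scheme \<Rightarrow> 'v set \<Rightarrow> bool" where
  "is_basis F V S \<longleftrightarrow> linearly_independent F V S \<and>
     (\<forall>\<alpha>\<in>carrier V. \<exists>\<alpha>s. distinct \<alpha>s \<and> set \<alpha>s \<subseteq> S \<and> linear_combination F V \<alpha> \<alpha>s)"

definition finite_dimensional ::
    "('f, 'm) hyperfield_scheme \<Rightarrow> ('v, 'f, 'n) hypervector_scheme \<Rightarrow> bool" where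
  "finite_dimensional F V \<longleftrightarrow> (\<exists>B. finite B \<and> is_basis F V B)"

end

theory Submission
  imports Defs
begin

text \<open>If a vector \<open>v\<close> takes part in a linear relation with nonzero coefficient \<open>c\<close>, say
  \<open>\<theta> \<in> c * v # u\<close> with \<open>u\<close> in a linear combination of a set \<open>S\<close>, then the vector of
  \<open>c * v\<close> involved is \<open>-u \<in> (-1) * u\<close>, and multiplying by the inverse of \<open>c\<close> recovers
  \<open>v\<close> as a linear combination of \<open>S\<close>; the one-sided distributive laws suffice for this.
  So adjoining to an independent set a vector outside its span keeps it independent, and an
  independent set that is maximal (which exists by Zorn's lemma, dependence being
  witnessed by finite subsets) is a basis.\<close>

section \<open>Hyperaddition of elements, sets and lists of sets\<close>

lemma set_hadd_mono: "A \<subseteq> A' \<Longrightarrow> B \<subseteq> B' \<Longrightarrow> A \<boxplus>\<^bsub>X\<^esub> B \<subseteq> A' \<boxplus>\<^bsub>X\<^esub> B'"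
  unfolding set_hadd_def by blast

context comm_hypergroup
begin

lemma hneg_closed: "a \<in> carrier X \<Longrightarrow> \<ominus> a \<in> carrier X"
  and zero_in_hadd_hneg: "a \<in> carrier X \<Longrightarrow> \<zero> \<in> a \<oplus> \<ominus> a"
  using theI'[OF hneg_unique[of a]] unfolding hneg_def by auto

text \<open>By commutativity one of the two memberships that characterise the negative already
  determines it.\<close>

lemma hneg_eqI:
  assumes "a \<in> carrier X" "b \<in> carrier X" "\<zero> \<in> a \<oplus> b"
  shows "\<ominus> a = b"
  using hneg_unique[OF assms(1)] hneg_closed zero_in_hadd_hneg hadd_comm assms by metis

text \<open>Neutrality of zero follows from reversibility: \<open>x\<close> in \<open>0 # a\<close>
  gives \<open>0\<close> in \<open>x # (-a)\<close>, so uniqueness of negatives makes both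
  \<open>x\<close> and \<open>a\<close> the negative of \<open>-a\<close>.\<close>

lemma zero_hadd:
  assumes "a \<in> carrier X"
  shows "\<zero> \<oplus> a = {a}"
proof -
  have "x = a" if "x \<in> \<zero> \<oplus> a" for x
  proof -
    have x: "x \<in> carrier X"
      using that hadd_subset[OF hzero_closed assms] by auto
    then have "\<zero> \<in> x \<oplus> \<ominus> a"
      using hadd_reversible[OF _ hzero_closed assms that] by simp
    then have "\<ominus> (\<ominus> a) = x"
      using hneg_eqI hneg_closed[OF assms] hadd_comm x by metis
    moreover have "\<ominus> (\<ominus> a) = a"
      using hneg_eqI hneg_closed[OF assms] zero_in_hadd_hneg[OF assms] hadd_comm assms by metis
    ultimately show ?thesis by simp
  qed
  then show ?thesis
    using hadd_nonempty[OF hzero_closed assms] by blast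
qed

lemma set_hadd_subset:
  "A \<subseteq> carrier X \<Longrightarrow> B \<subseteq> carrier X \<Longrightarrow> A \<boxplus> B \<subseteq> carrier X"
  unfolding set_hadd_def using hadd_subset by blast

lemma set_hadd_comm:
  assumes "A \<subseteq> carrier X" "B \<subseteq> carrier X"
  shows "A \<boxplus> B = B \<boxplus> A"
proof -
  have "A \<boxplus> B = (\<Union>a\<in>A. \<Union>b\<in>B. b \<oplus> a)"
    unfolding set_hadd_def using assms by (intro SUP_cong refl hadd_comm) auto
  also have "\<dots> = B \<boxplus> A"
    unfolding set_hadd_def by blast
  finally show ?thesis .
qed

lemma set_hadd_assoc:
  assumes "A \<subseteq> carrier X" "B \<subseteq> carrier X" "C \<subseteq> carrier X"
  shows "A \<boxplus> (B \<boxplus> C) = (A \<boxplus> B) \<boxplus> C"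
proof -
  have "A \<boxplus> (B \<boxplus> C) = (\<Union>a\<in>A. \<Union>b\<in>B. \<Union>c\<in>C. {a} \<boxplus> (b \<oplus> c))"
    unfolding set_hadd_def by blast
  also have "\<dots> = (\<Union>a\<in>A. \<Union>b\<in>B. \<Union>c\<in>C. (a \<oplus> b) \<boxplus> {c})"
    using assms by (intro SUP_cong refl hadd_assoc) auto
  also have "\<dots> = (A \<boxplus> B) \<boxplus> C"
    unfolding set_hadd_def by blast
  finally show ?thesis .
qed

lemma zero_set_hadd: "A \<subseteq> carrier X \<Longrightarrow> {\<zero>} \<boxplus> A = A"
  unfolding set_hadd_def using zero_hadd by fastforce

lemma set_hadd_zero: "A \<subseteq> carrier X \<Longrightarrow> A \<boxplus> {\<zero>} = A"
  using set_hadd_comm zero_set_hadd hzero_closed by auto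

text \<open>\<open>hsum\<close> treats one-element lists separately and adds no zero there; since
  \<open>{0}\<close> is neutral for sets, a uniform recursion holds after all.\<close>

lemma hsum_Cons: "A \<subseteq> carrier X \<Longrightarrow> hsum X (A # As) = A \<boxplus> hsum X As"
  by (cases As) (simp_all add: set_hadd_zero)

lemma hsum_subset: "\<forall>A\<in>set As. A \<subseteq> carrier X \<Longrightarrow> hsum X As \<subseteq> carrier X"
  by (induction As) (simp_all add: hsum_Cons set_hadd_subset hzero_closed)

text \<open>Serves to isolate one chosen vector of a relation, wherever the enumeration happens to
  place it.\<close>

lemma hsum_append_Cons:
  assumes "\<forall>A\<in>set As. A \<subseteq> carrier X" "B \<subseteq> carrier X" "\<forall>C\<in>set Cs. C \<subseteq> carrier X"
  shows "hsum X (As @ B # Cs) = B \<boxplus> hsum X (As @ Cs)"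
  using assms(1)
proof (induction As)
  case Nil
  then show ?case using assms(2) by (simp add: hsum_Cons)
next
  case (Cons A As)
  have A: "A \<subseteq> carrier X" using Cons.prems by simp
  have H: "hsum X (As @ Cs) \<subseteq> carrier X"
    using Cons.prems assms(3) by (intro hsum_subset) auto
  have "hsum X ((A # As) @ B # Cs) = A \<boxplus> (B \<boxplus> hsum X (As @ Cs))"
    using Cons A by (simp add: hsum_Cons)
  also have "\<dots> = B \<boxplus> (A \<boxplus> hsum X (As @ Cs))"
    using A assms(2) H by (metis set_hadd_assoc set_hadd_comm)
  finally show ?case using A by (simp add: hsum_Cons)
qed

end

section \<open>Scalar multiples and linear combinations\<close>

context hypervector_space
begin

lemma hypergroup_V: "comm_hypergroup V" and hypergroup_F: "comm_hypergroup F"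
  by unfold_locales

lemmas zero_vector_closed = comm_hypergroup.hzero_closed[OF hypergroup_V]
lemmas zero_scalar_closed = comm_hypergroup.hzero_closed[OF hypergroup_F]

text \<open>Write the zero vector as \<open>0 * \<theta>\<close> and use
  \<open>a * (0 * \<theta>) = (a 0) * \<theta> = 0 * \<theta>\<close>.\<close>

lemma smult_zero_vector:
  assumes "a \<in> carrier F"
  shows "a \<odot>\<^bsub>V\<^esub> \<zero>\<^bsub>V\<^esub> = {\<zero>\<^bsub>V\<^esub>}"
  using smult_assoc[OF assms zero_scalar_closed zero_vector_closed]
    smult_zero[OF zero_vector_closed] hmult_zero_right[OF assms] by simp

text \<open>As \<open>0\<close> lies in \<open>1 \<oplus> (-1)\<close>, the second distributive
  inclusion puts \<open>\<theta>\<close>, the only element of \<open>0 * u\<close>, into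
  \<open>u # (-1) * u\<close>. The element of \<open>(-1) * u\<close> responsible for this must be
  \<open>-u\<close>.\<close>

lemma hneg_in_smult:
  assumes u: "u \<in> carrier V"
  shows "\<ominus>\<^bsub>V\<^esub> u \<in> (\<ominus>\<^bsub>F\<^esub> \<one>\<^bsub>F\<^esub>) \<odot>\<^bsub>V\<^esub> u"
proof -
  have n: "\<ominus>\<^bsub>F\<^esub> \<one>\<^bsub>F\<^esub> \<in> carrier F"
    by (rule comm_hypergroup.hneg_closed[OF hypergroup_F hone_closed])
  have "\<zero>\<^bsub>V\<^esub> \<in> (\<Union>c\<in>\<one>\<^bsub>F\<^esub> \<oplus>\<^bsub>F\<^esub> \<ominus>\<^bsub>F\<^esub> \<one>\<^bsub>F\<^esub>. c \<odot>\<^bsub>V\<^esub> u)"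
    using comm_hypergroup.zero_in_hadd_hneg[OF hypergroup_F hone_closed] smult_zero[OF u] by blast
  then have "\<zero>\<^bsub>V\<^esub> \<in> {u} \<boxplus>\<^bsub>V\<^esub> ((\<ominus>\<^bsub>F\<^esub> \<one>\<^bsub>F\<^esub>) \<odot>\<^bsub>V\<^esub> u)"
    using smult_hadd_left[OF hone_closed n u] smult_one[OF u] by auto
  then obtain w where "w \<in> (\<ominus>\<^bsub>F\<^esub> \<one>\<^bsub>F\<^esub>) \<odot>\<^bsub>V\<^esub> u" "\<zero>\<^bsub>V\<^esub> \<in> u \<oplus>\<^bsub>V\<^esub> w"
    unfolding set_hadd_def by blast
  moreover from this have "\<ominus>\<^bsub>V\<^esub> u = w"
    using comm_hypergroup.hneg_eqI[OF hypergroup_V u] smult_subset[OF n u] by blast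
  ultimately show ?thesis by simp
qed

lemma smult_map2_subset:
  assumes "set as \<subseteq> carrier F" "set vs \<subseteq> carrier V"
  shows "\<forall>A\<in>set (map2 (\<lambda>a \<alpha>. a \<odot>\<^bsub>V\<^esub> \<alpha>) as vs). A \<subseteq> carrier V"
proof -
  have "a \<odot>\<^bsub>V\<^esub> v \<subseteq> carrier V" if "(a, v) \<in> set (zip as vs)" for a v
    using assms set_zip_leftD[OF that] set_zip_rightD[OF that] smult_subset by blast
  then show ?thesis by auto
qed

lemma comb_subset:
  "set as \<subseteq> carrier F \<Longrightarrow> set vs \<subseteq> carrier V \<Longrightarrow> comb V as vs \<subseteq> carrier V"
  unfolding comb_def
  by (rule comm_hypergroup.hsum_subset[OF hypergroup_V smult_map2_subset])

text \<open>The equal lengths of \<open>as\<close> and \<open>vs\<close> make the zipped lists pair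
  \<open>a\<close> with \<open>v\<close>.\<close>

lemma comb_append_Cons:
  assumes "length as = length vs" "set as \<subseteq> carrier F" "set vs \<subseteq> carrier V"
    and "a \<in> carrier F" "v \<in> carrier V" "set bs \<subseteq> carrier F" "set ws \<subseteq> carrier V"
  shows "comb V (as @ a # bs) (vs @ v # ws) = (a \<odot>\<^bsub>V\<^esub> v) \<boxplus>\<^bsub>V\<^esub> comb V (as @ bs) (vs @ ws)"
  using comm_hypergroup.hsum_append_Cons[OF hypergroup_V smult_map2_subset[OF assms(2,3)]
      smult_subset[OF assms(4,5)] smult_map2_subset[OF assms(6,7)]] assms(1)
  by (simp add: comb_def)

lemmas comb_Cons = comb_append_Cons[of "[]" "[]", simplified]

text \<open>Induction along the two lists; the first distributive law gives the inclusion in this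
  direction only. The empty combination is \<open>\<theta>\<close>, which every scalar
  fixes.\<close>

lemma smult_comb_subset:
  assumes "length as = length vs" "set as \<subseteq> carrier F" "set vs \<subseteq> carrier V"
    and b: "b \<in> carrier F"
  shows "(\<Union>u\<in>comb V as vs. b \<odot>\<^bsub>V\<^esub> u) \<subseteq> comb V (map (\<lambda>a. b \<otimes>\<^bsub>F\<^esub> a) as) vs"
  using assms(1-3)
proof (induction as vs rule: list_induct2)
  case Nil
  then show ?case using smult_zero_vector[OF b] by (simp add: comb_def)
next
  case (Cons a as v vs)
  let ?bs = "map (\<lambda>a. b \<otimes>\<^bsub>F\<^esub> a) as"
  have bs: "set ?bs \<subseteq> carrier F"
    using Cons.prems b hmult_closed by auto
  have "b \<odot>\<^bsub>V\<^esub> u \<subseteq> comb V ((b \<otimes>\<^bsub>F\<^esub> a) # ?bs) (v # vs)" if "u \<in> comb V (a # as) (v # vs)" for u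
  proof -
    have "u \<in> (a \<odot>\<^bsub>V\<^esub> v) \<boxplus>\<^bsub>V\<^esub> comb V as vs"
      using that Cons.prems by (simp add: comb_Cons)
    then obtain x y where x: "x \<in> a \<odot>\<^bsub>V\<^esub> v" and y: "y \<in> comb V as vs" and u: "u \<in> x \<oplus>\<^bsub>V\<^esub> y"
      unfolding set_hadd_def by blast
    have "x \<in> carrier V" "y \<in> carrier V"
      using x y Cons.prems comb_subset[of as vs] smult_subset[of a v] by auto
    from smult_hadd_right[OF b this]
    have "b \<odot>\<^bsub>V\<^esub> u \<subseteq> (b \<odot>\<^bsub>V\<^esub> x) \<boxplus>\<^bsub>V\<^esub> (b \<odot>\<^bsub>V\<^esub> y)" using u by blast
    moreover have "b \<odot>\<^bsub>V\<^esub> x \<subseteq> (b \<otimes>\<^bsub>F\<^esub> a) \<odot>\<^bsub>V\<^esub> v"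
      using x Cons.prems smult_assoc[OF b, of a v] by auto
    moreover have "b \<odot>\<^bsub>V\<^esub> y \<subseteq> comb V ?bs vs"
      using y Cons.IH Cons.prems by auto
    ultimately have "b \<odot>\<^bsub>V\<^esub> u \<subseteq> ((b \<otimes>\<^bsub>F\<^esub> a) \<odot>\<^bsub>V\<^esub> v) \<boxplus>\<^bsub>V\<^esub> comb V ?bs vs"
      by (meson order_trans set_hadd_mono)
    then show ?thesis
      using Cons.prems b bs hmult_closed by (simp add: comb_Cons)
  qed
  then show ?case by auto
qed

section \<open>Linear relations and adjoining a vector\<close>

lemma linear_combination_of_relation:
  assumes len: "length as = length vs" and as: "set as \<subseteq> carrier F" and vs: "set vs \<subseteq> carrier V"
    and c: "c \<in> carrier F" "c \<noteq> \<zero>\<^bsub>F\<^esub>" and v: "v \<in> carrier V"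
    and rel: "\<zero>\<^bsub>V\<^esub> \<in> (c \<odot>\<^bsub>V\<^esub> v) \<boxplus>\<^bsub>V\<^esub> comb V as vs"
  shows "linear_combination F V v vs"
proof -
  obtain w u where w: "w \<in> c \<odot>\<^bsub>V\<^esub> v" and u: "u \<in> comb V as vs" and wu: "\<zero>\<^bsub>V\<^esub> \<in> w \<oplus>\<^bsub>V\<^esub> u"
    using rel unfolding set_hadd_def by blast
  have wV: "w \<in> carrier V" and uV: "u \<in> carrier V"
    using w u smult_subset[OF c(1) v] comb_subset[OF as vs] by auto
  obtain d where d: "d \<in> carrier F" "c \<otimes>\<^bsub>F\<^esub> d = \<one>\<^bsub>F\<^esub>"
    using hmult_inverse[OF c] by blast
  have n: "\<ominus>\<^bsub>F\<^esub> \<one>\<^bsub>F\<^esub> \<in> carrier F"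
    by (rule comm_hypergroup.hneg_closed[OF hypergroup_F hone_closed])
  have "\<ominus>\<^bsub>V\<^esub> u = w"
    using comm_hypergroup.hneg_eqI[OF hypergroup_V uV wV] wu
      comm_hypergroup.hadd_comm[OF hypergroup_V uV wV] by simp
  \<comment> \<open>Here \<open>w = -u\<close> lies in \<open>(-1) * u\<close>, so mixed
    associativity turns \<open>d * w\<close> into part of a scalar multiple of \<open>u\<close>. The
    final coefficients are therefore \<open>d (-1) a\<close> for \<open>a\<close> in
    \<open>as\<close>.\<close>
  then have "d \<odot>\<^bsub>V\<^esub> w \<subseteq> (d \<otimes>\<^bsub>F\<^esub> \<ominus>\<^bsub>F\<^esub> \<one>\<^bsub>F\<^esub>) \<odot>\<^bsub>V\<^esub> u"
    using hneg_in_smult[OF uV] smult_assoc[OF d(1) n uV] by auto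
  moreover have "(\<Union>x\<in>c \<odot>\<^bsub>V\<^esub> v. d \<odot>\<^bsub>V\<^esub> x) = {v}"
    using smult_assoc[OF d(1) c(1) v] hmult_comm[OF d(1) c(1)] d(2) smult_one[OF v] by simp
  \<comment> \<open>A nonempty set among sets whose union is \<open>{v}\<close> equals
    \<open>{v}\<close>.\<close>
  then have "d \<odot>\<^bsub>V\<^esub> w = {v}"
    using w smult_nonempty[OF d(1) wV] by (metis UN_upper subset_singletonD)
  moreover have "(d \<otimes>\<^bsub>F\<^esub> \<ominus>\<^bsub>F\<^esub> \<one>\<^bsub>F\<^esub>) \<odot>\<^bsub>V\<^esub> u
      \<subseteq> comb V (map (\<lambda>a. (d \<otimes>\<^bsub>F\<^esub> \<ominus>\<^bsub>F\<^esub> \<one>\<^bsub>F\<^esub>) \<otimes>\<^bsub>F\<^esub> a) as) vs"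
    using smult_comb_subset[OF len as vs hmult_closed[OF d(1) n]] u by blast
  ultimately have "v \<in> comb V (map (\<lambda>a. (d \<otimes>\<^bsub>F\<^esub> \<ominus>\<^bsub>F\<^esub> \<one>\<^bsub>F\<^esub>) \<otimes>\<^bsub>F\<^esub> a) as) vs"
    by blast
  moreover have "set (map (\<lambda>a. (d \<otimes>\<^bsub>F\<^esub> \<ominus>\<^bsub>F\<^esub> \<one>\<^bsub>F\<^esub>) \<otimes>\<^bsub>F\<^esub> a) as) \<subseteq> carrier F"
    using as hmult_closed[OF hmult_closed[OF d(1) n]] by auto
  ultimately show ?thesis
    unfolding linear_combination_def using len by (metis length_map)
qed

lemma linearly_independent_insert:
  assumes S: "linearly_independent F V S" and v: "v \<in> carrier V"
    and not_comb: "\<And>vs. distinct vs \<Longrightarrow> set vs \<subseteq> S \<Longrightarrow> \<not> linear_combination F V v vs"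
  shows "linearly_independent F V (insert v S)"
proof (rule ccontr)
  have SV: "S \<subseteq> carrier V" and indep: "\<not> linearly_dependent F V S"
    using S unfolding linearly_independent_def by auto
  assume "\<not> linearly_independent F V (insert v S)"
  then obtain A where A: "A \<subseteq> insert v S" "finite A" "fin_linearly_dependent F V A"
    using SV v unfolding linearly_independent_def linearly_dependent_def by auto
  then obtain vs as where vs: "distinct vs" "set vs = A" and len: "length as = length vs"
    and as: "set as \<subseteq> carrier F" and nz: "\<exists>a\<in>set as. a \<noteq> \<zero>\<^bsub>F\<^esub>"
    and rel: "\<zero>\<^bsub>V\<^esub> \<in> comb V as vs"
    unfolding fin_linearly_dependent_def by blast
  have "v \<in> set vs"
    using A vs indep SV unfolding linearly_dependent_def by blast
  then obtain xs ys where split: "vs = xs @ v # ys" by (meson split_list)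
  \<comment> \<open>The coefficient list is cut at the position of \<open>v\<close>, so that
    \<open>c\<close> is the coefficient of \<open>v\<close> and \<open>bs\<close>, \<open>cs\<close>
    belong to \<open>xs\<close>, \<open>ys\<close>.\<close>
  define bs where "bs = take (length xs) as"
  define c where "c = as ! length xs"
  define cs where "cs = drop (Suc (length xs)) as"
  have lt: "length xs < length as" using len split by simp
  have as_eq: "as = bs @ c # cs"
    unfolding bs_def c_def cs_def using lt by (simp add: id_take_nth_drop)
  have len_bs: "length bs = length xs" and len_cs: "length cs = length ys"
    unfolding bs_def cs_def using len split by auto
  have dist: "distinct (xs @ ys)" and sub: "set (xs @ ys) \<subseteq> S"
    using vs A(1) split by auto
  have F: "set bs \<subseteq> carrier F" "c \<in> carrier F" "set cs \<subseteq> carrier F"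
    using as as_eq by auto
  have W: "set xs \<subseteq> carrier V" "set ys \<subseteq> carrier V"
    using sub SV by auto
  have rel': "\<zero>\<^bsub>V\<^esub> \<in> (c \<odot>\<^bsub>V\<^esub> v) \<boxplus>\<^bsub>V\<^esub> comb V (bs @ cs) (xs @ ys)"
    using rel comb_append_Cons[OF len_bs F(1) W(1) F(2) v F(3) W(2)] as_eq split by simp
  show False
  proof (cases "c = \<zero>\<^bsub>F\<^esub>")
    case True
    then have "\<zero>\<^bsub>V\<^esub> \<in> comb V (bs @ cs) (xs @ ys)"
      using rel' smult_zero[OF v] comb_subset[of "bs @ cs" "xs @ ys"] F W
        comm_hypergroup.zero_set_hadd[OF hypergroup_V] by simp
    \<comment> \<open>The coefficient known to be nonzero is not \<open>c\<close>, so it survives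
      the removal of \<open>v\<close>.\<close>
    moreover have "\<exists>a\<in>set (bs @ cs). a \<noteq> \<zero>\<^bsub>F\<^esub>"
      using nz True as_eq by auto
    ultimately have "fin_linearly_dependent F V (set (xs @ ys))"
      unfolding fin_linearly_dependent_def using dist F len_bs len_cs
      by (intro exI[of _ "xs @ ys"] exI[of _ "bs @ cs"]) auto
    then show False
      using indep SV sub unfolding linearly_dependent_def by blast
  next
    case False
    then have "linear_combination F V v (xs @ ys)"
      using linear_combination_of_relation[of "bs @ cs" "xs @ ys" c v] rel' F W v len_bs len_cs
      by auto
    then show False using not_comb dist sub by blast
  qed
qed

section \<open>Maximal independent sets and Zorn's lemma\<close>

lemma linear_combination_singleton:
  "v \<in> carrier V \<Longrightarrow> linear_combination F V v [v]"
  unfolding linear_combination_def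
  using smult_one hone_closed by (intro exI[of _ "[\<one>\<^bsub>F\<^esub>]"]) (simp add: comb_def)

text \<open>If \<open>v\<close> were no combination of \<open>M\<close>, adjoining it would keep
  independence, so maximality would force \<open>v\<close> into \<open>M\<close>; but then
  \<open>v\<close> is the combination \<open>1 * v\<close>.\<close>

lemma maximal_independent_is_basis:
  assumes M: "linearly_independent F V M"
    and max: "\<And>T. linearly_independent F V T \<Longrightarrow> M \<subseteq> T \<Longrightarrow> T = M"
  shows "is_basis F V M"
  unfolding is_basis_def
proof (intro conjI ballI)
  fix v assume v: "v \<in> carrier V"
  show "\<exists>vs. distinct vs \<and> set vs \<subseteq> M \<and> linear_combination F V v vs"
  proof (rule ccontr)
    assume no: "\<not> ?thesis"
    then have "linearly_independent F V (insert v M)"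
      using linearly_independent_insert[OF M v] by blast
    then have "v \<in> M" using max by blast
    then have "distinct [v]" "set [v] \<subseteq> M" by auto
    then show False using no linear_combination_singleton[OF v] by blast
  qed
qed (rule M)

text \<open>A finite subset of the union of a nonempty chain lies in a single member, so a
  dependence would already occur there.\<close>

lemma linearly_independent_Union_chain:
  assumes "C \<noteq> {}" "subset.chain \<A> C" "\<And>T. T \<in> C \<Longrightarrow> linearly_independent F V T"
  shows "linearly_independent F V (\<Union>C)"
proof -
  have sub: "\<Union>C \<subseteq> carrier V"
    using assms(3) unfolding linearly_independent_def by blast
  have "\<not> fin_linearly_dependent F V A" if A: "finite A" "A \<subseteq> \<Union>C" for A
  proof -
    obtain T where "T \<in> C" "A \<subseteq> T"
      using finite_subset_Union_chain[OF A assms(1,2)] by blast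
    then show ?thesis
      using A(1) assms(3) unfolding linearly_independent_def linearly_dependent_def by blast
  qed
  then show ?thesis
    using sub unfolding linearly_independent_def linearly_dependent_def by blast
qed

lemma linearly_independent_subset_basis:
  assumes "linearly_independent F V S"
  shows "\<exists>B. S \<subseteq> B \<and> is_basis F V B"
proof -
  let ?\<A> = "{T. S \<subseteq> T \<and> linearly_independent F V T}"
  have "\<exists>M\<in>?\<A>. \<forall>T\<in>?\<A>. M \<subseteq> T \<longrightarrow> T = M"
  \<comment> \<open>This form asks for bounds of nonempty chains only; the union of the empty chain
    need not contain \<open>S\<close>.\<close>
  proof (rule subset_Zorn_nonempty)
    show "?\<A> \<noteq> {}" using assms by blast
    fix C assume C: "C \<noteq> {}" "subset.chain ?\<A> C"
    then have "T \<in> ?\<A>" if "T \<in> C" for T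
      using that unfolding subset.chain_def by blast
    then show "\<Union>C \<in> ?\<A>"
      using C linearly_independent_Union_chain[OF C] by blast
  qed
  then obtain M where "S \<subseteq> M" "linearly_independent F V M"
    and max: "\<forall>T\<in>?\<A>. M \<subseteq> T \<longrightarrow> T = M"
    by auto
  \<comment> \<open>Maximality among independent supersets of \<open>S\<close> is maximality among
    all independent sets, since any \<open>T\<close> above \<open>M\<close> contains
    \<open>S\<close>.\<close>
  moreover have "T = M" if "linearly_independent F V T" "M \<subseteq> T" for T
    using that max \<open>S \<subseteq> M\<close> by (simp add: subset_trans)
  ultimately have "S \<subseteq> M" "is_basis F V M"
    using maximal_independent_is_basis by simp_all
  then show ?thesis by blast
qed

end

theorem theorem6p3:
  fixes F :: "('f, 'm) hyperfield_scheme"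
    and V :: "('v, 'f, 'n) hypervector_scheme"
    and S :: "'v set"
  assumes "hypervector_space F V"
    and "finite_dimensional F V"
    and "linearly_independent F V S"
  shows "is_basis F V S \<or> (\<exists>B. S \<subset> B \<and> is_basis F V B)"
  \<comment> \<open>The basis containing \<open>S\<close> either equals \<open>S\<close> or contains
    it properly, which gives the two alternatives.\<close>
  using hypervector_space.linearly_independent_subset_basis[OF assms(1,3)] by blast

end
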